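(* Let $q$ be a prime power, $m\ge 1$ an integer, $n=q^m-1$, and let $\alpha$ be a primitive $n$-th root of unity over $\mathbb{F}_q$. Let $\{i_1,\ldots,i_t\}$ be the set of all $q$-cyclotomic coset leaders modulo $n$. Let $C$ be a cyclic code of length $n$ over $\mathbb{F}_q$. Then $C$ is LCD if and only if for every $1\le j\le t$, $\alpha^{i_j}\in \mathrm{BZ}(C^\perp)$ implies that either $B_{i_j}=B_{-i_j}$ or $\alpha^{-i_j}\in \mathrm{BZ}(C^\perp)$.
   Context: A linear code of length $n$ over $\mathbb{F}_q$ is a subspace of $\mathbb{F}_q^n$; $C^\perp$ denotes its dual under the Euclidean inner product. $C$ is LCD (linear complementary dual) if $C\cap C^\perp=\{0\}$. A linear code is cyclic if it is closed under cyclic shifts; identifying $(c_0,\ldots,c_{n-1})$ with $\sum c_ix^i$, a cyclic code is an ideal of $\mathbb{F}_q[x]/(x^n-1)$, and its generator polynomial is the unique monic divisor $g(x)$ of $x^n-1$ generating it (for the zero code, $g(x)=x^n-1$). The $q$-cyclotomic coset of an integer $a$ modulo $n$ is $B_a=\{a,aq,\ldots,aq^{\delta_a-1}\}\subseteq\mathbb{Z}_n$ (reduced mod $n$), where $\delta_a=|B_a|$ is the smallest positive integer with $aq^{\delta_a}\equiv a \pmod n$. These cosets partition $\mathbb{Z}_n$; a set of coset leaders contains exactly one representative of each coset. For an integer $i$, $m_{\alpha^i}(x)=\prod_{s\in B_i}(x-\alpha^s)$ is the minimal polynomial of $\alpha^i$ over $\mathbb{F}_q$. If $E$ is a cyclic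 code of length $n$ whose generator polynomial is $\prod_{j\in S}m_{\alpha^{i_j}}(x)$ with $S\subseteq\{1,\ldots,t\}$, then $\mathrm{BZ}(E)=\{\alpha^{i_j}: j\in S\}$; thus $\mathrm{BZ}(C^\perp)$ (the basic dual zero of $C$) is computed from the generator polynomial of $C^\perp$. Convention: the condition $\alpha^{-i_j}\in\mathrm{BZ}(C^\perp)$ is understood up to the choice of coset representative, i.e. it means $\alpha^{i_k}\in\mathrm{BZ}(C^\perp)$ for the leader $i_k$ with $i_k\in B_{-i_j}$. *)

theory Defs
  imports
    "Jordan_Normal_Form.VS_Connect"
    "HOL-Number_Theory.Cong"
    "HOL-Number_Theory.Prime_Powers"
begin

definition linear_code :: "nat \<Rightarrow> 'a::field vec set \<Rightarrow> bool" where
  "linear_code n C \<longleftrightarrow> VectorSpace.subspace class_ring C (module_vec TYPE('a) n)"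

definition dual_code :: "nat \<Rightarrow> 'a::field vec set \<Rightarrow> 'a vec set" where
  "dual_code n C = {v \<in> carrier_vec n. \<forall>c\<in>C. v \<bullet> c = 0}"

definition LCD_code :: "nat \<Rightarrow> 'a::field vec set \<Rightarrow> bool" where
  "LCD_code n C \<longleftrightarrow> C \<inter> dual_code n C = {0\<^sub>v n}"

(* (c_0, ..., c_{n-1}) is sent to (c_{n-1}, c_0, ..., c_{n-2}) *)
definition cyclic_shift :: "'a vec \<Rightarrow> 'a vec" where
  "cyclic_shift c = vec (dim_vec c) (\<lambda>k. c $ ((k + dim_vec c - 1) mod dim_vec c))"

definition cyclic_code :: "nat \<Rightarrow> 'a::field vec set \<Rightarrow> bool" where
  "cyclic_code n C \<longleftrightarrow> linear_code n C \<and> (\<forall>c\<in>C. cyclic_shift c \<in> C)"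

definition code_poly :: "'a::field vec \<Rightarrow> 'a poly" where
  "code_poly c = (\<Sum>k<dim_vec c. Polynomial.monom (c $ k) k)"

definition xn1 :: "nat \<Rightarrow> 'a::field poly" where
  "xn1 n = Polynomial.monom 1 n - 1"

(* Elements of F[x]/(x^n - 1) are represented by their remainders modulo x^n - 1, so the set on
   the right-hand side of the last equation is the ideal generated by the class of g. *)
definition is_generator_poly :: "nat \<Rightarrow> 'a::field vec set \<Rightarrow> 'a poly \<Rightarrow> bool" where
  "is_generator_poly n C g \<longleftrightarrow>
     lead_coeff g = 1 \<and> g dvd xn1 n \<and> code_poly ` C = {(f * g) mod xn1 n | f. True}"

definition generator_poly :: "nat \<Rightarrow> 'a::field vec set \<Rightarrow> 'a poly" where
  "generator_poly n C = (THE g. is_generator_poly n C g)"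

definition coset_size :: "nat \<Rightarrow> nat \<Rightarrow> int \<Rightarrow> nat" where
  "coset_size q n a = (LEAST d. 0 < d \<and> [a * int q ^ d = a] (mod int n))"

(* Z_n is represented by {0..<int n}; the argument a is an arbitrary integer *)
definition cyc_coset :: "nat \<Rightarrow> nat \<Rightarrow> int \<Rightarrow> int set" where
  "cyc_coset q n a = (\<lambda>k. (a * int q ^ k) mod int n) ` {..<coset_size q n a}"

definition coset_leaders :: "nat \<Rightarrow> nat \<Rightarrow> nat \<Rightarrow> (nat \<Rightarrow> int) \<Rightarrow> bool" where
  "coset_leaders q n t i \<longleftrightarrow>
     (\<forall>j\<in>{1..t}. i j \<in> {0..<int n}) \<and>
     (\<forall>a\<in>{0..<int n}. \<exists>!j. j \<in> {1..t} \<and> i j \<in> cyc_coset q n a)"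

definition primitive_nth_root :: "nat \<Rightarrow> 'b::field \<Rightarrow> bool" where
  "primitive_nth_root n \<alpha> \<longleftrightarrow> \<alpha> ^ n = 1 \<and> (\<forall>k. 0 < k \<and> k < n \<longrightarrow> \<alpha> ^ k \<noteq> 1)"

definition coset_poly :: "nat \<Rightarrow> nat \<Rightarrow> 'b::field \<Rightarrow> int \<Rightarrow> 'b poly" where
  "coset_poly q n \<alpha> a = (\<Prod>s\<in>cyc_coset q n a. [:- (\<alpha> powi s), 1:])"

(* The generator polynomial has coefficients in F_q, the minimal polynomials are written as products
   over the extension field containing \<alpha>; emb is the embedding of F_q into that field. *)
definition BZ :: "('a::field \<Rightarrow> 'b::field) \<Rightarrow> nat \<Rightarrow> nat \<Rightarrow> 'b \<Rightarrow> nat \<Rightarrow> (nat \<Rightarrow> int) \<Rightarrow> 'a vec set \<Rightarrow> 'b set" where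
  "BZ emb q n \<alpha> t i E =
     (\<lambda>j. \<alpha> powi (i j)) `
       (THE S. S \<subseteq> {1..t} \<and>
          map_poly emb (generator_poly n E) = (\<Prod>j\<in>S. coset_poly q n \<alpha> (i j)))"

end

theory Submission
  imports Defs "Jordan_Normal_Form.Char_Poly" "HOL-Number_Theory.Residues"
begin

text \<open>
  Over the extension field a cyclic code is determined by the set of \<open>n\<close>-th roots of unity at which
  all codewords vanish; such sets are exactly the sets of roots of unity closed under
  \<open>\<beta> \<mapsto> \<beta> ^ q\<close>, because \<open>\<Prod>(x - \<beta>)\<close> over such a set is fixed by the Frobenius map and hence has
  coefficients in the base field. Evaluating the cross-correlation of \<open>v\<close> and \<open>c\<close> at \<open>\<beta>\<close> gives
  \<open>v(\<beta>) c(\<beta>\<^sup>-\<^sup>1)\<close>, so the zero set \<open>D\<close> of the dual code consists of the inverses of the non-zeros of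
  \<open>C\<close>. The intersection of the two codes has the union of the two zero sets as its zero set, so it
  is trivial iff this union contains all roots of unity, i.e. iff \<open>D\<close> is closed under inversion.
  As \<open>D\<close> is a union of cyclotomic classes, this can be tested on coset leaders.
\<close>

section \<open>Monic polynomials with simple roots at a prescribed finite set\<close>

definition root_poly :: "'a::field set \<Rightarrow> 'a poly" where
  "root_poly R = (\<Prod>\<beta>\<in>R. [:- \<beta>, 1:])"

lemma degree_root_poly: "degree (root_poly R) = card R"
  unfolding root_poly_def by (subst degree_prod_eq_sum_degree) auto

lemma lead_coeff_root_poly: "lead_coeff (root_poly R) = 1"
  unfolding root_poly_def lead_coeff_prod by simp

lemma poly_root_poly_eq_0_iff: "finite R \<Longrightarrow> poly (root_poly R) x = 0 \<longleftrightarrow> x \<in> R"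
  unfolding root_poly_def poly_prod by (auto simp: prod_zero_iff)

text \<open>The leading terms cancel in the difference, which then has too small a degree to vanish
  on all of \<open>R\<close> unless it is zero.\<close>

lemma root_poly_eqI:
  assumes "lead_coeff p = 1" "degree p = card R" "finite R" "\<And>x. x \<in> R \<Longrightarrow> poly p x = 0"
  shows "p = root_poly R"
proof (rule poly_eqI_degree_lead_coeff[where A = R and n = "card R"])
  show "Polynomial.coeff p (card R) = Polynomial.coeff (root_poly R) (card R)"
    using assms lead_coeff_root_poly[of R] by (simp add: degree_root_poly)
qed (use assms in \<open>auto simp: degree_root_poly poly_root_poly_eq_0_iff\<close>)

text \<open>The remainder modulo \<open>root_poly R\<close> vanishes on \<open>R\<close> but has
  degree below \<open>card R\<close>. The empty set is split off because a zero remainder has degree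
  0, which is not below \<open>card {}\<close>.\<close>

lemma root_poly_dvd:
  assumes "finite R" "\<And>x. x \<in> R \<Longrightarrow> poly p x = 0"
  shows "root_poly R dvd p"
proof (cases "R = {}")
  case False
  let ?r = "p mod root_poly R"
  have nz: "root_poly R \<noteq> 0"
    using lead_coeff_root_poly[of R] by auto
  have "card R > 0" using False assms(1) by (simp add: card_gt_0_iff)
  then have "degree ?r < card R"
    using degree_mod_less[OF nz, of p] by (auto simp: degree_root_poly)
  moreover have "poly ?r x = poly 0 x" if "x \<in> R" for x
  proof -
    have "poly p x = poly (p div root_poly R * root_poly R + ?r) x" by simp
    also have "\<dots> = poly ?r x"
      using poly_root_poly_eq_0_iff[OF assms(1), of x] that by (simp only: poly_add poly_mult) simp
    finally show ?thesis using assms(2)[OF that] by simp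
  qed
  ultimately have "?r = 0"
    using \<open>card R > 0\<close> by (intro poly_eqI_degree[where A = R]) auto
  then show ?thesis by (simp add: mod_eq_0_iff_dvd)
qed (simp add: root_poly_def)

text \<open>Injectivity keeps the number of roots equal to the degree. For a Frobenius map permuting
  \<open>R\<close> this says that the coefficients of \<open>root_poly R\<close> are fixed.\<close>

lemma (in field_hom) map_poly_root_poly:
  assumes "finite R"
  shows "map_poly hom (root_poly R) = root_poly (hom ` R)"
proof (rule root_poly_eqI)
  show "degree (map_poly hom (root_poly R)) = card (hom ` R)"
    by (simp add: degree_map_poly_hom degree_root_poly card_image inj_on_subset[OF inj_f])
  show "lead_coeff (map_poly hom (root_poly R)) = 1"
    by (simp only: hom_lead_coeff lead_coeff_root_poly hom_one)
  show "poly (map_poly hom (root_poly R)) x = 0" if "x \<in> hom ` R" for x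
    using that assms by (auto simp: poly_root_poly_eq_0_iff)
qed (use assms in auto)

subsection \<open>Frobenius endomorphism\<close>

text \<open>Multiplication by a nonzero \<open>x\<close> permutes the nonzero elements; comparing
  their product before and after, and cancelling it, gives
  \<open>x ^ (card UNIV - 1) = 1\<close>.\<close>

lemma finite_field_power_card:
  fixes x :: "'a::{field,finite}"
  shows "x ^ card (UNIV :: 'a set) = x"
proof (cases "x = 0")
  case False
  let ?U = "UNIV - {0::'a}"
  have "(\<Prod>y\<in>?U. x * y) = \<Prod>?U"
    by (rule prod.reindex_bij_witness[of _ "\<lambda>y. y / x" "\<lambda>y. x * y"]) (use False in auto)
  then have "x ^ card ?U * \<Prod>?U = \<Prod>?U"
    by (simp add: prod.distrib)
  then have "x ^ card ?U = 1" by auto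
  moreover have "card (UNIV :: 'a set) = Suc (card ?U)"
    by (metis UNIV_I card.remove finite)
  ultimately show ?thesis by (simp only: power_Suc mult_1_right)
qed (simp add: zero_power card_gt_0_iff)

text \<open>Translation by 1 permutes the field, so adding 1 to every element leaves the sum of all
  elements unchanged.\<close>

lemma of_nat_card_eq_0: "of_nat (card (UNIV :: 'a set)) = (0::'a::{field,finite})"
proof -
  have "(\<Sum>x\<in>UNIV. x + 1) = (\<Sum>x\<in>UNIV. x::'a)"
    by (rule sum.reindex_bij_witness[of _ "\<lambda>x. x - 1" "\<lambda>x. x + 1"]) auto
  then show ?thesis by (simp add: sum.distrib)
qed

lemma card_eq_CHAR_power:
  assumes "primepow (card (UNIV :: 'a::{field,finite} set))"
  obtains k where "card (UNIV :: 'a set) = CHAR('a) ^ k" "prime CHAR('a)"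
proof -
  obtain p k where p: "prime p" "card (UNIV :: 'a set) = p ^ k"
    using assms unfolding primepow_def by auto
  have dvd: "CHAR('a) dvd p ^ k"
    using of_nat_card_eq_0[where 'a='a] unfolding p(2) of_nat_eq_0_iff_char_dvd .
  have pr: "prime CHAR('a)"
    by (rule prime_CHAR_semidom) (use finite_imp_CHAR_pos[OF finite[of "UNIV::'a set"]] in auto)
  have "CHAR('a) dvd p" using dvd pr prime_dvd_power by blast
  then have "CHAR('a) = p" using pr p(1) primes_dvd_imp_eq by blast
  then show ?thesis using that p pr by simp
qed

text \<open>An injective homomorphism kills the same multiples of 1. This transfers the
  characteristic, and with it the freshman's dream, to the extension field.\<close>

lemma (in field_hom) CHAR_eq: "CHAR('b) = CHAR('a)"
proof (rule CHAR_eqI)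
  have *: "(of_nat k :: 'b) = hom (of_nat k)" for k
    by (induction k) (simp_all add: hom_add)
  show "of_nat CHAR('a) = (0::'b)" by (simp add: *)
  show "CHAR('a) dvd k" if "of_nat k = (0::'b)" for k
    using that by (simp add: * of_nat_eq_0_iff_char_dvd)
qed

locale finite_field_extension = field_hom emb
  for emb :: "'a::{field,finite} \<Rightarrow> 'b::field" +
  fixes q :: nat
  assumes primepow_q: "primepow q" and card_q: "card (UNIV :: 'a set) = q"
begin

lemma field_hom_frobenius: "field_hom (\<lambda>x::'b. x ^ q)"
proof -
  obtain k where "q = CHAR('a) ^ k" "prime CHAR('a)"
    using card_eq_CHAR_power[where 'a='a] primepow_q card_q by auto
  then have "(x + y) ^ q = x ^ q + y ^ q" for x y :: 'b
    using freshmans_dream'[where 'a='b] CHAR_eq by metis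
  moreover have "q > 0" using primepow_q primepow_gt_0_nat by blast
  ultimately show ?thesis
    by unfold_locales (auto simp: power_mult_distrib)
qed

lemma emb_power_q: "emb x ^ q = emb x"
proof -
  have "emb x ^ q = emb (x ^ q)" by (rule hom_power[symmetric])
  also have "x ^ q = x" using finite_field_power_card[of x] by (simp only: card_q)
  finally show ?thesis .
qed

text \<open>The image of the base field supplies \<open>q\<close> roots of \<open>x ^ q - x\<close>,
  and a nonzero polynomial of degree \<open>q\<close> has no further ones.\<close>

lemma range_emb_iff: "x \<in> range emb \<longleftrightarrow> x ^ q = x"
proof -
  let ?p = "Polynomial.monom 1 q - [:0, 1:] :: 'b poly"
  have "q > 1" using primepow_gt_Suc_0[OF primepow_q] unfolding One_nat_def .
  then have deg: "degree ?p = q"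
    by (subst diff_conv_add_uminus, subst degree_add_eq_left) (auto simp: degree_monom_eq)
  then have nz: "?p \<noteq> 0" using \<open>q > 1\<close> by force
  have roots: "{x. poly ?p x = 0} = {x. x ^ q = x}"
    by (auto simp: poly_monom)
  have fin: "finite {x::'b. x ^ q = x}"
    using poly_roots_finite[OF nz] roots by simp
  have "card {x::'b. x ^ q = x} \<le> q"
    using card_poly_roots_bound[OF nz] deg roots by simp
  moreover have "card (range emb) = q"
    using card_q inj_f by (simp add: card_image)
  ultimately have "range emb = {x. x ^ q = x}"
    using emb_power_q fin by (intro card_seteq) auto
  then show ?thesis by auto
qed

text \<open>The injective Frobenius map permutes the finite set \<open>R\<close>, hence fixes every
  coefficient of \<open>root_poly R\<close>; fixed elements are exactly those of the base
  field.\<close>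

lemma root_poly_in_range:
  assumes "finite R" "\<And>x. x \<in> R \<Longrightarrow> x ^ q \<in> R"
  obtains p where "map_poly emb p = root_poly R"
proof -
  define fr :: "'b \<Rightarrow> 'b" where "fr = (\<lambda>x. x ^ q)"
  interpret F: field_hom fr
    using field_hom_frobenius unfolding fr_def .
  have "fr ` R = R"
    by (rule endo_inj_surj) (use assms F.inj_f in \<open>auto simp: fr_def intro: inj_on_subset\<close>)
  then have "map_poly fr (root_poly R) = root_poly R"
    using F.map_poly_root_poly[OF assms(1)] by simp
  then have "fr (Polynomial.coeff (root_poly R) k) = Polynomial.coeff (root_poly R) k" for k
    by (metis F.hom_zero coeff_map_poly)
  then have "Polynomial.coeff (root_poly R) k ^ q = Polynomial.coeff (root_poly R) k" for k
    by (simp add: fr_def)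
  then have *: "Polynomial.coeff (root_poly R) k \<in> range emb" for k
    using range_emb_iff by simp
  \<comment> \<open>The preimage is taken coefficientwise; \<open>coeff_map_poly\<close> needs the
    inverse to send 0 to 0.\<close>
  have "map_poly emb (map_poly (inv_into UNIV emb) (root_poly R)) = root_poly R"
  proof (rule poly_eqI)
    fix k
    have "inv_into UNIV emb 0 = 0" by (metis hom_zero inv_f_f inj_f)
    then show "Polynomial.coeff (map_poly emb (map_poly (inv_into UNIV emb) (root_poly R))) k
        = Polynomial.coeff (root_poly R) k"
      using *[of k] by (simp add: coeff_map_poly f_inv_into_f)
  qed
  then show ?thesis using that by blast
qed

end

subsection \<open>Codes as polynomials\<close>

lemma coeff_code_poly: "Polynomial.coeff (code_poly c) k = (if k < dim_vec c then c $ k else 0)"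
proof -
  have "(\<Sum>j<dim_vec c. if j = k then c $ j else 0) = (if k < dim_vec c then c $ k else 0)"
    by (simp add: sum.delta)
  then show ?thesis unfolding code_poly_def by (simp add: Polynomial.coeff_sum)
qed

lemma degree_code_poly_less:
  assumes "n > 0" "c \<in> carrier_vec n"
  shows "degree (code_poly c) < n"
  using assms by (intro degree_lessI) (auto simp: coeff_code_poly)

lemma inj_on_code_poly: "inj_on code_poly (carrier_vec n)"
proof (rule inj_onI)
  fix c d :: "'a vec" assume *: "c \<in> carrier_vec n" "d \<in> carrier_vec n" "code_poly c = code_poly d"
  show "c = d"
  proof (rule eq_vecI)
    fix k assume "k < dim_vec d"
    then show "c $ k = d $ k"
      using * coeff_code_poly[of c k] coeff_code_poly[of d k] by auto
  qed (use * in auto)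
qed

lemma code_poly_vec_coeff:
  assumes "degree p < n"
  shows "code_poly (vec n (Polynomial.coeff p)) = p"
  using assms by (intro poly_eqI) (auto simp: coeff_code_poly coeff_eq_0)

lemma code_poly_zero: "code_poly (0\<^sub>v n) = 0"
  by (rule poly_eqI) (auto simp: coeff_code_poly)

lemma code_poly_add:
  "\<lbrakk>c \<in> carrier_vec n; d \<in> carrier_vec n\<rbrakk> \<Longrightarrow> code_poly (c + d) = code_poly c + code_poly d"
  by (rule poly_eqI) (auto simp: coeff_code_poly)

lemma code_poly_smult: "code_poly (a \<cdot>\<^sub>v c) = Polynomial.smult a (code_poly c)"
  by (rule poly_eqI) (auto simp: coeff_code_poly)

lemma degree_xn1:
  assumes "n > 0"
  shows "degree (xn1 n :: 'a::field poly) = n"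
  unfolding xn1_def using assms
  by (subst diff_conv_add_uminus, subst degree_add_eq_left) (auto simp: degree_monom_eq)

lemma lead_coeff_xn1: "n > 0 \<Longrightarrow> lead_coeff (xn1 n :: 'a::field poly) = 1"
  by (simp add: degree_xn1) (simp add: xn1_def)

lemma xn1_nonzero: "n > 0 \<Longrightarrow> (xn1 n :: 'a::field poly) \<noteq> 0"
  by (metis lead_coeff_xn1 leading_coeff_0_iff zero_neq_one)

lemma code_poly_mod_xn1:
  "\<lbrakk>n > 0; c \<in> carrier_vec n\<rbrakk> \<Longrightarrow> code_poly c mod xn1 n = code_poly c"
  by (simp add: mod_poly_less degree_xn1 degree_code_poly_less)

text \<open>Multiplication by \<open>x\<close> pushes the top coefficient to degree
  \<open>n\<close>; subtracting that multiple of \<open>x ^ n - 1\<close> wraps it around to degree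
  0.\<close>

lemma code_poly_cyclic_shift:
  assumes n: "n > 0" and c: "c \<in> carrier_vec n"
  shows "code_poly (cyclic_shift c) = pCons 0 (code_poly c) mod xn1 n"
proof -
  have d: "cyclic_shift c \<in> carrier_vec n" using c by (auto simp: cyclic_shift_def)
  have "pCons 0 (code_poly c) = code_poly (cyclic_shift c) + [:c $ (n - 1):] * xn1 n"
  proof (rule poly_eqI)
    fix k
    have "(k + n - 1) mod n = (if k = 0 then n - 1 else k - 1)" if "k < n"
      using that by (auto simp: mod_if)
    then show "Polynomial.coeff (pCons 0 (code_poly c)) k =
      Polynomial.coeff (code_poly (cyclic_shift c) + [:c $ (n - 1):] * xn1 n) k"
      using c n by (auto simp: coeff_code_poly cyclic_shift_def xn1_def coeff_pCons split: nat.splits)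
  qed
  then have "pCons 0 (code_poly c) mod xn1 n = code_poly (cyclic_shift c) mod xn1 n"
    by (simp only: mod_mult_self1)
  then show ?thesis using code_poly_mod_xn1[OF n d] by simp
qed

lemma linear_code_iff:
  "linear_code n C \<longleftrightarrow> C \<subseteq> carrier_vec n \<and> 0\<^sub>v n \<in> C \<and>
     (\<forall>v\<in>C. \<forall>w\<in>C. v + w \<in> C) \<and> (\<forall>a. \<forall>v\<in>C. a \<cdot>\<^sub>v v \<in> C)"
proof -
  interpret V: vec_space "TYPE('a)" n .
  show ?thesis
    unfolding linear_code_def VectorSpace.subspace_def LinearCombinations.submodule_def
    using V.vectorspace_axioms V.module_axioms by (auto simp: module_vec_simps)
qed

subsection \<open>Generator polynomials\<close>

lemma cyclic_codeD:
  assumes "cyclic_code n C"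
  shows "C \<subseteq> carrier_vec n" "0\<^sub>v n \<in> C" "\<And>v w. \<lbrakk>v \<in> C; w \<in> C\<rbrakk> \<Longrightarrow> v + w \<in> C"
    "\<And>a v. v \<in> C \<Longrightarrow> a \<cdot>\<^sub>v v \<in> C" "\<And>v. v \<in> C \<Longrightarrow> cyclic_shift v \<in> C"
  using assms unfolding cyclic_code_def linear_code_iff by auto

text \<open>Modulo \<open>x ^ n - 1\<close> the polynomial \<open>g'\<close> is a multiple of
  \<open>g\<close>, and \<open>g\<close> divides the modulus. By symmetry two generators divide each
  other, and being monic they agree.\<close>

lemma generator_dvd:
  assumes "is_generator_poly n C g" "is_generator_poly n C g'"
  shows "g dvd g'"
proof -
  have "(1 * g') mod xn1 n \<in> code_poly ` C"
    using assms(2) unfolding is_generator_poly_def by blast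
  then obtain f where f: "g' mod xn1 n = (f * g) mod xn1 n"
    using assms(1) unfolding is_generator_poly_def by auto
  have g: "g dvd xn1 n" using assms(1) unfolding is_generator_poly_def by blast
  then have "g dvd g' mod xn1 n" unfolding f by (simp add: dvd_mod)
  then show ?thesis using g by (simp add: dvd_mod_iff)
qed

text \<open>The code is pulled back to an ideal of the polynomial ring, where a monic element of
  least degree divides all others by division with remainder.\<close>

lemma generator_exists:
  assumes n: "n > 0" and C: "cyclic_code n C"
  shows "\<exists>g. is_generator_poly n C g"
proof -
  note C = cyclic_codeD[OF C]
  define I where "I = {f. \<exists>c\<in>C. f mod xn1 n = code_poly c}"
  have add: "f + g \<in> I" if fg: "f \<in> I" "g \<in> I" for f g
  proof -
    obtain c d where "c \<in> C" "f mod xn1 n = code_poly c" "d \<in> C" "g mod xn1 n = code_poly d"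
      using fg unfolding I_def by blast
    moreover from this C(1) have "c \<in> carrier_vec n" "d \<in> carrier_vec n" by blast+
    ultimately have "(f + g) mod xn1 n = code_poly (c + d)" "c + d \<in> C"
      using C(3) by (simp_all add: poly_mod_add_left code_poly_add)
    then show ?thesis unfolding I_def by auto
  qed
  have smult: "Polynomial.smult a f \<in> I" if f: "f \<in> I" for a f
  proof -
    obtain c where "c \<in> C" "f mod xn1 n = code_poly c"
      using f unfolding I_def by auto
    then have "Polynomial.smult a f mod xn1 n = code_poly (a \<cdot>\<^sub>v c)" "a \<cdot>\<^sub>v c \<in> C"
      using C(4) by (auto simp: mod_smult_left code_poly_smult)
    then show ?thesis unfolding I_def by auto
  qed
  have shift: "pCons 0 f \<in> I" if f: "f \<in> I" for f
  proof -
    obtain c where c: "c \<in> C" "f mod xn1 n = code_poly c"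
      using f unfolding I_def by auto
    have "pCons 0 f mod xn1 n = ([:0, 1:] * f) mod xn1 n" by simp
    also have "\<dots> = ([:0, 1:] * (f mod xn1 n)) mod xn1 n" by (simp only: mod_mult_right_eq)
    also have "\<dots> = pCons 0 (code_poly c) mod xn1 n" by (simp add: c)
    also have "\<dots> = code_poly (cyclic_shift c)"
      using code_poly_cyclic_shift[OF n subsetD[OF C(1) c(1)]] by simp
    finally show ?thesis using C(5)[OF c(1)] unfolding I_def by auto
  qed
  \<comment> \<open>Horner's scheme reduces an arbitrary multiplier to scalars and multiplication by
    \<open>x\<close>.\<close>
  have mult: "h * f \<in> I" if f: "f \<in> I" for h f
  proof (induction h)
    case 0
    show ?case using smult[OF f, of 0] by simp
  next
    case (pCons a h)
    show ?case using add[OF smult[OF f, of a] shift[OF pCons.IH]] by (simp add: mult_pCons_left)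
  qed
  \<comment> \<open>This guarantees a nonzero element to minimise over even for the zero code, and
    later yields \<open>g dvd xn1 n\<close>.\<close>
  have "xn1 n \<in> I" using C(2) unfolding I_def by (auto intro!: bexI[of _ "0\<^sub>v n"] simp: code_poly_zero)
  then obtain g0 where g0: "g0 \<in> I" "g0 \<noteq> 0" "\<And>f. \<lbrakk>f \<in> I; f \<noteq> 0\<rbrakk> \<Longrightarrow> degree g0 \<le> degree f"
    using ex_has_least_nat[of "\<lambda>f. f \<in> I \<and> f \<noteq> 0" "xn1 n" degree] xn1_nonzero[OF n] by blast
  define g where "g = Polynomial.smult (inverse (lead_coeff g0)) g0"
  have g: "g \<in> I" "lead_coeff g = 1" "degree g = degree g0"
    using smult[OF g0(1)] g0(2) by (auto simp: g_def)
  have g_dvd: "g dvd f" if f: "f \<in> I" for f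
  proof (rule ccontr)
    assume ndvd: "\<not> g dvd f"
    have "f mod g = f + Polynomial.smult (-1) (f div g * g)"
      by (simp add: minus_div_mult_eq_mod[symmetric])
    then have "f mod g \<in> I" using add[OF f smult[OF mult[OF g(1)]]] by metis
    moreover have "f mod g \<noteq> 0" using ndvd by (simp add: mod_eq_0_iff_dvd)
    ultimately have "degree g0 \<le> degree (f mod g)" by (rule g0(3))
    moreover have "degree (f mod g) < degree g"
      by (rule degree_mod_less') (use g \<open>f mod g \<noteq> 0\<close> in auto)
    ultimately show False using g(3) by simp
  qed
  have "code_poly ` C = {(f * g) mod xn1 n | f. True}"
  proof (intro equalityI subsetI)
    fix x assume "x \<in> code_poly ` C"
    then obtain c where c: "c \<in> C" "x = code_poly c" by auto
    have mod: "x mod xn1 n = x" using code_poly_mod_xn1[OF n subsetD[OF C(1) c(1)]] c by simp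
    then have "x \<in> I" using c unfolding I_def by auto
    then obtain f where "x = f * g" using g_dvd by (metis dvdE mult.commute)
    then have "x = (f * g) mod xn1 n" using mod by simp
    then show "x \<in> {(f * g) mod xn1 n | f. True}" by blast
  next
    fix x assume "x \<in> {(f * g) mod xn1 n | f. True}"
    then obtain f where "x = (f * g) mod xn1 n" by blast
    then show "x \<in> code_poly ` C" using mult[OF g(1), of f] unfolding I_def by auto
  qed
  then show ?thesis
    unfolding is_generator_poly_def using g(2) g_dvd[OF \<open>xn1 n \<in> I\<close>] by blast
qed

lemma is_generator_poly_generator_poly:
  assumes "n > 0" "cyclic_code n C"
  shows "is_generator_poly n C (generator_poly n C)"
  unfolding generator_poly_def
proof (rule theI')
  have "g = g'" if "is_generator_poly n C g" "is_generator_poly n C g'" for g g'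
    using generator_dvd[OF that] generator_dvd[OF that(2,1)] that
    by (intro poly_dvd_antisym) (auto simp: is_generator_poly_def)
  then show "\<exists>!g. is_generator_poly n C g"
    using generator_exists[OF assms] by blast
qed

lemma poly_mod_xn1:
  assumes "\<beta> ^ n = 1"
  shows "poly (p mod xn1 n) \<beta> = poly p \<beta>"
proof -
  have "poly (xn1 n) \<beta> = 0" using assms by (simp add: xn1_def poly_monom)
  then have "poly (p div xn1 n * xn1 n + p mod xn1 n) \<beta> = poly (p mod xn1 n) \<beta>"
    by (simp only: poly_add poly_mult) simp
  then show ?thesis by simp
qed

lemma cyclic_shift_carrier [simp]: "cyclic_shift c \<in> carrier_vec n \<longleftrightarrow> c \<in> carrier_vec n"
  unfolding carrier_vec_def cyclic_shift_def by simp

lemma cyclic_shift_power_carrier: "c \<in> carrier_vec n \<Longrightarrow> (cyclic_shift ^^ k) c \<in> carrier_vec n"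
  by (induction k) auto

text \<open>The index is \<open>l - k\<close> modulo \<open>n\<close>; the case split avoids
  truncated subtraction on naturals.\<close>

lemma cyclic_shift_power_index:
  assumes "c \<in> carrier_vec n" "k \<le> n" "l < n"
  shows "(cyclic_shift ^^ k) c $ l = c $ (if k \<le> l then l - k else l + n - k)"
  using assms(2,3)
proof (induction k arbitrary: l)
  case (Suc k)
  let ?l = "if l = 0 then n - 1 else l - 1"
  have "(cyclic_shift ^^ Suc k) c $ l = (cyclic_shift ^^ k) c $ ((l + n - 1) mod n)"
    using cyclic_shift_power_carrier[OF assms(1), of k] Suc.prems
    by (simp add: cyclic_shift_def)
  also have "(l + n - 1) mod n = ?l" using Suc.prems by (auto simp: mod_if)
  also have "(cyclic_shift ^^ k) c $ ?l = c $ (if k \<le> ?l then ?l - k else ?l + n - k)"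
    by (rule Suc.IH) (use Suc.prems in auto)
  also have "(if k \<le> ?l then ?l - k else ?l + n - k) = (if Suc k \<le> l then l - Suc k else l + n - Suc k)"
    using Suc.prems by auto
  finally show ?case .
qed simp

subsection \<open>Zeros of cyclic codes and their duals\<close>

locale cyclic_code_zeros = finite_field_extension emb q
  for emb :: "'a::{field,finite} \<Rightarrow> 'b::field" and q :: nat +
  fixes n :: nat and \<alpha> :: 'b
  assumes n_pos: "n > 0" and primitive: "primitive_nth_root n \<alpha>"
begin

definition U :: "'b set" where "U = {\<beta>. \<beta> ^ n = 1}"

lemma alpha_nonzero: "\<alpha> \<noteq> 0"
  using primitive n_pos unfolding primitive_nth_root_def by (metis power_eq_0_iff zero_neq_one)

lemma finite_U: "finite U" and card_U_le: "card U \<le> n"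
proof -
  have U: "U = {\<beta>. poly (xn1 n) \<beta> = 0}"
    by (simp add: U_def xn1_def poly_monom)
  show "finite U" unfolding U by (rule poly_roots_finite[OF xn1_nonzero[OF n_pos]])
  show "card U \<le> n"
    unfolding U using card_poly_roots_bound[OF xn1_nonzero[OF n_pos]] degree_xn1[OF n_pos]
    by metis
qed

text \<open>By primitivity the \<open>n\<close> powers are distinct, and \<open>U\<close>, as the
  root set of \<open>x ^ n - 1\<close>, has no room for more.\<close>

lemma bij_betw_powi: "bij_betw (\<lambda>s. \<alpha> powi s) {0..<int n} U"
proof -
  have alpha_n: "\<alpha> ^ n = 1" and min: "\<And>k. \<lbrakk>0 < k; k < n\<rbrakk> \<Longrightarrow> \<alpha> ^ k \<noteq> 1"
    using primitive unfolding primitive_nth_root_def by auto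
  have neq: "\<alpha> powi a \<noteq> \<alpha> powi b" if "0 \<le> a" "a < b" "b < int n" for a b
  proof
    assume eq: "\<alpha> powi a = \<alpha> powi b"
    have "\<alpha> powi b = \<alpha> powi a * \<alpha> powi (b - a)"
      using alpha_nonzero by (simp flip: power_int_add)
    then have "\<alpha> powi (b - a) = 1" using eq alpha_nonzero by simp
    then have "\<alpha> ^ nat (b - a) = 1" using that by (simp add: power_int_def)
    moreover have "0 < nat (b - a)" "nat (b - a) < n" using that by auto
    ultimately show False using min by blast
  qed
  have inj: "inj_on (\<lambda>s. \<alpha> powi s) {0..<int n}"
  proof (rule inj_onI)
    fix a b assume "a \<in> {0..<int n}" "b \<in> {0..<int n}" "\<alpha> powi a = \<alpha> powi b"
    then show "a = b" using neq[of a b] neq[of b a] by (cases a b rule: linorder_cases) auto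
  qed
  have sub: "(\<lambda>s. \<alpha> powi s) ` {0..<int n} \<subseteq> U"
  proof (rule image_subsetI)
    fix s assume "s \<in> {0..<int n}"
    have "(\<alpha> powi s) ^ n = (\<alpha> ^ n) powi s"
      by (metis mult.commute power_int_mult power_int_of_nat)
    then show "\<alpha> powi s \<in> U" unfolding U_def alpha_n by simp
  qed
  have "(\<lambda>s. \<alpha> powi s) ` {0..<int n} = U"
    by (rule card_seteq[OF finite_U sub]) (simp add: card_image[OF inj] card_U_le)
  then show ?thesis using inj by (simp add: bij_betw_def)
qed

lemma card_U: "card U = n"
  using bij_betw_same_card[OF bij_betw_powi] by simp

lemma U_nonzero: "\<beta> \<in> U \<Longrightarrow> \<beta> \<noteq> 0"
  using n_pos unfolding U_def by (auto simp: zero_power)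

lemma inverse_in_U: "\<beta> \<in> U \<Longrightarrow> inverse \<beta> \<in> U"
  unfolding U_def by (simp add: power_inverse)

lemma power_in_U: "\<beta> \<in> U \<Longrightarrow> \<beta> ^ k \<in> U"
  unfolding U_def by (simp add: power_mult[symmetric] mult.commute[of k]) (simp add: power_mult)

lemma map_poly_emb_mult: "map_poly emb (f * g) = map_poly emb f * map_poly emb g"
proof -
  interpret map_poly_hom: map_poly_inj_idom_hom emb ..
  show ?thesis by (rule map_poly_hom.hom_mult)
qed

lemma map_poly_xn1: "map_poly emb (xn1 n) = xn1 n"
  by (rule poly_eqI) (simp add: xn1_def coeff_map_poly hom_distribs)

text \<open>As \<beta> runs through the powers of \<alpha>, this is the discrete Fourier transform
  of the word over the extension field.\<close>

definition ev :: "'a vec \<Rightarrow> 'b \<Rightarrow> 'b" where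
  "ev c \<beta> = poly (map_poly emb (code_poly c)) \<beta>"

lemma ev_sum: "ev c \<beta> = (\<Sum>k<dim_vec c. emb (c $ k) * \<beta> ^ k)"
proof -
  have "map_poly emb (code_poly c) = code_poly (map_vec emb c)"
    by (rule poly_eqI) (simp add: coeff_code_poly coeff_map_poly)
  then show ?thesis
    by (simp add: ev_def code_poly_def poly_sum poly_monom)
qed

text \<open>Frobenius fixes the embedded coefficients, so it commutes with evaluation. Hence zero
  sets are stable under \<open>q\<close>-th powers.\<close>

lemma ev_power_q: "ev c (\<beta> ^ q) = ev c \<beta> ^ q"
proof -
  define fr :: "'b \<Rightarrow> 'b" where "fr = (\<lambda>x. x ^ q)"
  interpret F: field_hom fr
    using field_hom_frobenius unfolding fr_def .
  have "fr (emb x) = emb x" for x by (simp add: fr_def emb_power_q)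
  then have "map_poly fr (map_poly emb (code_poly c)) = map_poly emb (code_poly c)"
    by (intro poly_eqI) simp
  then have "poly (map_poly emb (code_poly c)) (fr \<beta>) = fr (ev c \<beta>)"
    unfolding ev_def by (metis F.poly_map_poly)
  then show ?thesis by (simp add: ev_def fr_def)
qed

lemma ev_code_poly_mod:
  assumes "\<beta> \<in> U" "code_poly c = p mod xn1 n"
  shows "ev c \<beta> = poly (map_poly emb p) \<beta>"
  using assms unfolding ev_def U_def
  by (simp add: map_poly_mod map_poly_xn1 poly_mod_xn1)

lemma ev_cyclic_shift:
  assumes "\<beta> \<in> U" "c \<in> carrier_vec n"
  shows "ev (cyclic_shift c) \<beta> = \<beta> * ev c \<beta>"
  using ev_code_poly_mod[OF assms(1) code_poly_cyclic_shift[OF n_pos assms(2)]]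
  by (simp add: ev_def map_poly_pCons_hom)

definition zeros :: "'a vec set \<Rightarrow> 'b set" where
  "zeros E = {\<beta> \<in> U. \<forall>c\<in>E. ev c \<beta> = 0}"

lemma zeros_subset_U: "zeros E \<subseteq> U" and finite_zeros: "finite (zeros E)"
  using finite_U unfolding zeros_def by auto

lemma zeros_power_q: "\<beta> \<in> zeros E \<Longrightarrow> \<beta> ^ q \<in> zeros E"
  using primepow_gt_0_nat[OF primepow_q]
  by (auto simp: zeros_def ev_power_q power_in_U zero_power)

text \<open>Every codeword is a multiple of \<open>g\<close> modulo \<open>x ^ n - 1\<close>, and
  \<open>g\<close> reduced is itself a codeword.\<close>

lemma poly_generator_eq_0_iff:
  assumes "is_generator_poly n C g" "\<beta> \<in> U"
  shows "poly (map_poly emb g) \<beta> = 0 \<longleftrightarrow> \<beta> \<in> zeros C"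
proof -
  have C: "code_poly ` C = {(f * g) mod xn1 n | f. True}"
    using assms(1) unfolding is_generator_poly_def by blast
  show ?thesis
  proof
    assume 0: "poly (map_poly emb g) \<beta> = 0"
    have "ev c \<beta> = 0" if c: "c \<in> C" for c
    proof -
      obtain f where "code_poly c = (f * g) mod xn1 n"
        using C c by blast
      from ev_code_poly_mod[OF assms(2) this] show ?thesis
        using 0 by (simp add: map_poly_emb_mult)
    qed
    then show "\<beta> \<in> zeros C" using assms(2) unfolding zeros_def by blast
  next
    assume \<beta>: "\<beta> \<in> zeros C"
    have "(1 * g) mod xn1 n \<in> code_poly ` C" using C by blast
    then obtain c where c: "c \<in> C" "(1 * g) mod xn1 n = code_poly c" by blast
    have "ev c \<beta> = poly (map_poly emb (1 * g)) \<beta>"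
      by (rule ev_code_poly_mod[OF assms(2) c(2)[symmetric]])
    then show "poly (map_poly emb g) \<beta> = 0"
      using \<beta> c(1) unfolding zeros_def by simp
  qed
qed

text \<open>Write \<open>x ^ n - 1 = g * h\<close>. The factor \<open>g\<close> vanishes on
  \<open>zeros C\<close> and \<open>h\<close> on the remaining roots of unity; since the degrees add
  up to \<open>n = card U\<close>, both degree bounds are attained.\<close>

lemma map_poly_generator:
  assumes g: "is_generator_poly n C g"
  shows "map_poly emb g = root_poly (zeros C)"
proof (rule root_poly_eqI)
  let ?G = "map_poly emb g"
  have monic: "lead_coeff g = 1" and dvd: "g dvd xn1 n"
    using g unfolding is_generator_poly_def by auto
  show "lead_coeff ?G = 1" using monic by (simp only: hom_lead_coeff hom_one)
  show root: "poly ?G \<beta> = 0" if "\<beta> \<in> zeros C" for \<beta>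
    using that poly_generator_eq_0_iff[OF g] zeros_subset_U by blast
  obtain h where h: "xn1 n = g * h" using dvd by blast
  let ?H = "map_poly emb h"
  have GH: "xn1 n = ?G * ?H"
    using map_poly_xn1 unfolding h map_poly_emb_mult by simp
  have nz: "?G \<noteq> 0" "?H \<noteq> 0"
    using GH xn1_nonzero[OF n_pos, where 'a='b] by auto
  have degs: "degree ?G + degree ?H = n"
    using degree_mult_eq[OF nz] degree_xn1[OF n_pos, where 'a='b] unfolding GH by simp
  have "poly ?H \<beta> = 0" if "\<beta> \<in> U - zeros C" for \<beta>
  proof -
    have "poly (xn1 n) \<beta> = 0" using that by (simp add: U_def xn1_def poly_monom)
    moreover have "poly ?G \<beta> \<noteq> 0" using that poly_generator_eq_0_iff[OF g] by blast
    ultimately show ?thesis unfolding GH by simp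
  qed
  then have "card (U - zeros C) \<le> degree ?H"
    using dvd_imp_degree_le[OF root_poly_dvd nz(2), of "U - zeros C"] finite_U
    by (simp add: degree_root_poly)
  moreover have "card (zeros C) \<le> degree ?G"
    using dvd_imp_degree_le[OF root_poly_dvd nz(1), of "zeros C"] finite_zeros root
    by (simp add: degree_root_poly)
  moreover have "card (U - zeros C) + card (zeros C) = n"
    using card_Diff_subset[OF finite_zeros zeros_subset_U] card_mono[OF finite_U zeros_subset_U]
      card_U by simp
  ultimately show "degree ?G = card (zeros C)" using degs by linarith
qed (rule finite_zeros)

lemma cyclic_code_memI:
  assumes C: "cyclic_code n C" and v: "v \<in> carrier_vec n" "\<And>\<beta>. \<beta> \<in> zeros C \<Longrightarrow> ev v \<beta> = 0"
  shows "v \<in> C"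
proof -
  obtain g where g: "is_generator_poly n C g" using generator_exists[OF n_pos C] by blast
  have "root_poly (zeros C) dvd map_poly emb (code_poly v)"
    using root_poly_dvd[OF finite_zeros] v(2) unfolding ev_def by blast
  \<comment> \<open>Divisibility over the extension field descends, because both polynomials have
    coefficients in the base field.\<close>
  then have "g dvd code_poly v"
    using map_poly_generator[OF g] dvd_map_poly_hom_imp_dvd by metis
  then obtain f where "code_poly v = f * g" by (metis dvdE mult.commute)
  then have "code_poly v = (f * g) mod xn1 n"
    using code_poly_mod_xn1[OF n_pos v(1)] by simp
  then have "code_poly v \<in> code_poly ` C"
    using g unfolding is_generator_poly_def by blast
  then obtain c where "c \<in> C" "code_poly v = code_poly c" by blast
  then show ?thesis
    using inj_onD[OF inj_on_code_poly, of v c n] v(1) cyclic_codeD(1)[OF C] by blast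
qed

text \<open>The word is \<open>root_poly R\<close> read over the base field; \<open>R\<close> being
  a proper subset of \<open>U\<close> keeps its degree below \<open>n\<close>. It serves to separate
  codes by their zeros.\<close>

lemma exists_vec_with_zeros:
  assumes R: "R \<subset> U" "\<And>\<beta>. \<beta> \<in> R \<Longrightarrow> \<beta> ^ q \<in> R"
  obtains v where "v \<in> carrier_vec n" "\<And>\<beta>. ev v \<beta> = 0 \<longleftrightarrow> \<beta> \<in> R"
proof -
  have fin: "finite R" using R(1) finite_U finite_subset by blast
  obtain p where p: "map_poly emb p = root_poly R"
    using root_poly_in_range[OF fin R(2)] by blast
  have "degree p = card R" using p degree_root_poly by (metis degree_map_poly_hom)
  also have "\<dots> < n" using psubset_card_mono[OF finite_U R(1)] card_U by simp
  finally have "ev (vec n (Polynomial.coeff p)) \<beta> = poly (root_poly R) \<beta>" for \<beta>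
    unfolding ev_def by (simp add: code_poly_vec_coeff p)
  then show ?thesis
    using that[of "vec n (Polynomial.coeff p)"] poly_root_poly_eq_0_iff[OF fin] by simp
qed

text \<open>A polynomial of degree below \<open>n\<close> cannot have \<open>n\<close> roots unless
  it is zero: the Fourier transform is injective.\<close>

lemma eq_zero_vecI:
  assumes v: "v \<in> carrier_vec n" "\<And>\<beta>. \<beta> \<in> U \<Longrightarrow> ev v \<beta> = 0"
  shows "v = 0\<^sub>v n"
proof -
  have "map_poly emb (code_poly v) = 0"
    by (rule poly_eqI_degree[where A = U])
      (use v degree_code_poly_less[OF n_pos v(1)] card_U n_pos in \<open>auto simp: ev_def\<close>)
  then have "code_poly v = code_poly (0\<^sub>v n)" by (simp add: code_poly_zero)
  then show ?thesis using inj_onD[OF inj_on_code_poly, of v "0\<^sub>v n" n] v(1) by simp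
qed

section \<open>Duality through cross-correlation\<close>

text \<open>Cross-correlation theorem: the \<open>k\<close>-th inner product pairs entry
  \<open>l\<close> of \<open>v\<close> with entry \<open>l - k\<close> of \<open>c\<close>, and
  \<open>\<beta> ^ k\<close> splits as \<open>\<beta> ^ l\<close> times the inverse of
  \<open>\<beta> ^ (l - k)\<close>; wrap-around is absorbed by
  \<open>\<beta> ^ n = 1\<close>.\<close>

lemma sum_cyclic_shift_power:
  assumes "v \<in> carrier_vec n" "c \<in> carrier_vec n" "\<beta> \<in> U"
  shows "(\<Sum>k<n. emb (v \<bullet> (cyclic_shift ^^ k) c) * \<beta> ^ k) = ev v \<beta> * ev c (inverse \<beta>)"
proof -
  have [simp]: "dim_vec v = n" "dim_vec c = n" "dim_vec ((cyclic_shift ^^ k) c) = n" for k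
    using assms cyclic_shift_power_carrier[OF assms(2), of k] by auto
  have \<beta>: "\<beta> ^ n = 1" "\<beta> \<noteq> 0" using assms(3) U_nonzero by (auto simp: U_def)
  have inner: "(\<Sum>k<n. emb ((cyclic_shift ^^ k) c $ l) * \<beta> ^ k) = \<beta> ^ l * ev c (inverse \<beta>)"
    if l: "l < n" for l
  proof -
    \<comment> \<open>This is \<open>l - k\<close> modulo \<open>n\<close>, an involution of
      \<open>{..<n}\<close>, so it is its own inverse in the reindexing below.\<close>
    define \<sigma> where "\<sigma> k = (if k \<le> l then l - k else l + n - k)" for k
    have pow: "\<beta> ^ k = \<beta> ^ l * inverse \<beta> ^ \<sigma> k" if k: "k < n" for k
    proof -
      have "k + \<sigma> k = l \<or> k + \<sigma> k = l + n" using k by (auto simp: \<sigma>_def)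
      then have "\<beta> ^ k * \<beta> ^ \<sigma> k = \<beta> ^ l"
        using \<beta>(1) by (metis mult.right_neutral power_add)
      then show ?thesis using \<beta>(2) by (simp add: field_simps)
    qed
    have "(\<Sum>k<n. emb ((cyclic_shift ^^ k) c $ l) * \<beta> ^ k)
        = (\<Sum>k<n. emb (c $ \<sigma> k) * (\<beta> ^ l * inverse \<beta> ^ \<sigma> k))"
    proof (rule sum.cong[OF refl])
      fix k assume k: "k \<in> {..<n}"
      have "(cyclic_shift ^^ k) c $ l = c $ \<sigma> k"
        unfolding \<sigma>_def by (rule cyclic_shift_power_index) (use assms(2) k l in auto)
      then show "emb ((cyclic_shift ^^ k) c $ l) * \<beta> ^ k
          = emb (c $ \<sigma> k) * (\<beta> ^ l * inverse \<beta> ^ \<sigma> k)"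
        using pow k by simp
    qed
    also have "\<dots> = (\<Sum>j<n. emb (c $ j) * (\<beta> ^ l * inverse \<beta> ^ j))"
      by (rule sum.reindex_bij_witness[of _ \<sigma> \<sigma>]) (use l in \<open>auto simp: \<sigma>_def split: if_splits\<close>)
    also have "\<dots> = \<beta> ^ l * ev c (inverse \<beta>)"
      by (simp add: ev_sum sum_distrib_left mult.left_commute)
    finally show ?thesis .
  qed
  have "(\<Sum>k<n. emb (v \<bullet> (cyclic_shift ^^ k) c) * \<beta> ^ k)
      = (\<Sum>k<n. \<Sum>l<n. emb (v $ l) * (emb ((cyclic_shift ^^ k) c $ l) * \<beta> ^ k))"
    by (simp add: scalar_prod_def hom_sum hom_mult sum_distrib_right mult.assoc atLeast0LessThan)
  also have "\<dots> = (\<Sum>l<n. \<Sum>k<n. emb (v $ l) * (emb ((cyclic_shift ^^ k) c $ l) * \<beta> ^ k))"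
    by (rule sum.swap)
  also have "\<dots> = (\<Sum>l<n. emb (v $ l) * (\<beta> ^ l * ev c (inverse \<beta>)))"
    by (rule sum.cong[OF refl]) (simp add: inner flip: sum_distrib_left)
  also have "\<dots> = ev v \<beta> * ev c (inverse \<beta>)"
    by (simp add: ev_sum sum_distrib_right mult.assoc)
  finally show ?thesis .
qed

text \<open>As \<open>C\<close> is closed under shifts, orthogonality to \<open>C\<close> means that
  all cross-correlations with codewords vanish, that is,
  \<open>ev v \<beta> * ev c (inverse \<beta>) = 0\<close> for all \<open>c\<close> in
  \<open>C\<close> and \<beta> in \<open>U\<close>.\<close>

lemma dual_code_iff:
  assumes C: "cyclic_code n C"
  shows "v \<in> dual_code n C \<longleftrightarrow>
    v \<in> carrier_vec n \<and> (\<forall>\<beta>\<in>U. inverse \<beta> \<notin> zeros C \<longrightarrow> ev v \<beta> = 0)"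
proof (intro iffI conjI ballI impI)
  assume v: "v \<in> dual_code n C"
  then show v_carrier: "v \<in> carrier_vec n" by (simp add: dual_code_def)
  fix \<beta> assume \<beta>: "\<beta> \<in> U" "inverse \<beta> \<notin> zeros C"
  then obtain c where c: "c \<in> C" "ev c (inverse \<beta>) \<noteq> 0"
    using inverse_in_U unfolding zeros_def by blast
  have "(cyclic_shift ^^ k) c \<in> C" for k
    using c(1) cyclic_codeD(5)[OF C] by (induction k) auto
  then have "v \<bullet> (cyclic_shift ^^ k) c = 0" for k
    using v by (simp add: dual_code_def)
  then have "ev v \<beta> * ev c (inverse \<beta>) = 0"
    using sum_cyclic_shift_power[OF v_carrier subsetD[OF cyclic_codeD(1)[OF C] c(1)] \<beta>(1)] by simp
  then show "ev v \<beta> = 0" using c(2) by simp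
next
  assume v: "v \<in> carrier_vec n \<and> (\<forall>\<beta>\<in>U. inverse \<beta> \<notin> zeros C \<longrightarrow> ev v \<beta> = 0)"
  have "v \<bullet> c = 0" if c: "c \<in> C" for c
  proof -
    have c_carrier: "c \<in> carrier_vec n" using cyclic_codeD(1)[OF C] c by blast
    \<comment> \<open>The vector of all inner products with shifts of \<open>c\<close>; its
      transform vanishes on \<open>U\<close>, and its entry 0 is the wanted inner product.\<close>
    define w where "w = vec n (\<lambda>k. v \<bullet> (cyclic_shift ^^ k) c)"
    have "ev w \<beta> = 0" if \<beta>: "\<beta> \<in> U" for \<beta>
    proof -
      have "ev w \<beta> = ev v \<beta> * ev c (inverse \<beta>)"
        using sum_cyclic_shift_power[of v c \<beta>] v c_carrier \<beta> by (simp add: ev_sum w_def)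
      also have "\<dots> = 0"
        using v c \<beta> unfolding zeros_def by (cases "inverse \<beta> \<in> zeros C") (auto simp: zeros_def)
      finally show ?thesis .
    qed
    then have "w = 0\<^sub>v n" by (intro eq_zero_vecI) (auto simp: w_def)
    then have "w $ 0 = 0" using n_pos by simp
    then show ?thesis using n_pos by (simp add: w_def)
  qed
  then show "v \<in> dual_code n C" using v by (simp add: dual_code_def)
qed

lemma cyclic_dual_code:
  fixes C :: "'a vec set"
  assumes C: "cyclic_code n C"
  shows "cyclic_code n (dual_code n C)"
proof -
  note C_carrier = cyclic_codeD(1)[OF C]
  have "linear_code n (dual_code n C)"
    unfolding linear_code_iff
  proof (intro conjI ballI allI)
    fix v w a assume vw: "v \<in> dual_code n C"
    show "a \<cdot>\<^sub>v v \<in> dual_code n C"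
      using vw C_carrier smult_scalar_prod_distrib unfolding dual_code_def by force
    assume "w \<in> dual_code n C"
    then show "v + w \<in> dual_code n C"
      using vw C_carrier add_scalar_prod_distrib[of v n w] unfolding dual_code_def by force
  qed (use C_carrier in \<open>auto simp: dual_code_def\<close>)
  \<comment> \<open>In the transform picture a shift only multiplies the value at \<beta> by
    \<beta>, so vanishing is preserved.\<close>
  moreover have "cyclic_shift v \<in> dual_code n C" if "v \<in> dual_code n C" for v
    using that unfolding dual_code_iff[OF C] by (simp add: ev_cyclic_shift)
  ultimately show ?thesis unfolding cyclic_code_def by blast
qed

text \<open>The description of the dual code makes \<open>D\<close> a set of common zeros. That
  there are no others needs a dual codeword vanishing exactly on \<open>D\<close>, which exists
  because \<open>D\<close> is Frobenius-stable.\<close>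

lemma zeros_dual_code:
  assumes C: "cyclic_code n C"
  shows "zeros (dual_code n C) = {\<beta> \<in> U. inverse \<beta> \<notin> zeros C}"
proof -
  define D where "D = {\<beta> \<in> U. inverse \<beta> \<notin> zeros C}"
  have "ev v \<beta> = 0" if "\<beta> \<in> D" "v \<in> dual_code n C" for v \<beta>
    using that dual_code_iff[OF C] unfolding D_def by blast
  then have "D \<subseteq> zeros (dual_code n C)" unfolding zeros_def D_def by blast
  moreover have "zeros (dual_code n C) \<subseteq> D"
  proof (rule subsetI, rule ccontr)
    fix \<beta> assume \<beta>: "\<beta> \<in> zeros (dual_code n C)" "\<beta> \<notin> D"
    have frob: "\<gamma> ^ q \<in> D" if \<gamma>: "\<gamma> \<in> D" for \<gamma>
    proof -
      have "inverse \<gamma> \<in> U" "inverse \<gamma> \<notin> zeros C" using \<gamma> inverse_in_U unfolding D_def by auto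
      then obtain c where "c \<in> C" "ev c (inverse \<gamma>) \<noteq> 0" unfolding zeros_def by blast
      then have "ev c (inverse (\<gamma> ^ q)) \<noteq> 0"
        using ev_power_q[of c "inverse \<gamma>"] by (simp add: power_inverse)
      then show ?thesis using \<open>c \<in> C\<close> \<gamma> power_in_U unfolding D_def zeros_def by blast
    qed
    \<comment> \<open>The supposed extra zero \<beta> lies in \<open>U\<close> but not in
      \<open>D\<close>, which makes the inclusion strict as the construction of \<open>v\<close>
      requires.\<close>
    have "D \<subset> U" using \<beta> zeros_subset_U unfolding D_def by blast
    from exists_vec_with_zeros[OF this frob]
    obtain v where v: "v \<in> carrier_vec n" "\<And>\<gamma>. ev v \<gamma> = 0 \<longleftrightarrow> \<gamma> \<in> D" by blast
    then have "v \<in> dual_code n C" unfolding dual_code_iff[OF C] D_def by blast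
    then have "ev v \<beta> = 0" using \<beta>(1) unfolding zeros_def by blast
    then show False using v(2) \<beta>(2) by blast
  qed
  ultimately show ?thesis unfolding D_def by blast
qed

text \<open>Since \<open>?D\<close> consists of the inverses of the non-zeros of \<open>C\<close>,
  it is closed under inversion iff \<open>zeros C\<close> and \<open>?D\<close> together cover
  \<open>U\<close>, which is when only the zero word lies in both codes.\<close>

lemma LCD_code_iff_zeros:
  assumes C: "cyclic_code n C"
  shows "LCD_code n C \<longleftrightarrow> (\<forall>\<beta>\<in>zeros (dual_code n C). inverse \<beta> \<in> zeros (dual_code n C))"
    (is "_ \<longleftrightarrow> (\<forall>\<beta>\<in>?D. inverse \<beta> \<in> ?D)")
proof
  assume LCD: "LCD_code n C"
  show "\<forall>\<beta>\<in>?D. inverse \<beta> \<in> ?D"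
  proof (rule ballI, rule ccontr)
    fix \<beta> assume \<beta>: "\<beta> \<in> ?D" "inverse \<beta> \<notin> ?D"
    have "inverse \<beta> \<in> U" using \<beta>(1) zeros_subset_U inverse_in_U by blast
    moreover have "inverse \<beta> \<notin> zeros C" using \<beta>(1) unfolding zeros_dual_code[OF C] by blast
    \<comment> \<open>The element \<open>inverse \<beta>\<close> is missed by both sets, so a word
      with exactly these zeros lies in both codes without being zero.\<close>
    ultimately have "zeros C \<union> ?D \<subset> U" using \<beta>(2) zeros_subset_U by blast
    then obtain v where v: "v \<in> carrier_vec n" "\<And>\<gamma>. ev v \<gamma> = 0 \<longleftrightarrow> \<gamma> \<in> zeros C \<union> ?D"
      using exists_vec_with_zeros[of "zeros C \<union> ?D"] zeros_power_q by blast
    have "v \<in> C \<inter> dual_code n C"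
      using cyclic_code_memI[OF C v(1)] cyclic_code_memI[OF cyclic_dual_code[OF C] v(1)] v(2)
      by blast
    then have "v = 0\<^sub>v n" using LCD unfolding LCD_code_def by blast
    then have "ev v (inverse \<beta>) = 0" by (simp add: ev_def code_poly_zero)
    then show False using v(2) \<beta>(2) \<open>inverse \<beta> \<notin> zeros C\<close> by blast
  qed
next
  assume D: "\<forall>\<beta>\<in>?D. inverse \<beta> \<in> ?D"
  have "v = 0\<^sub>v n" if v: "v \<in> C" "v \<in> dual_code n C" for v
  proof (rule eq_zero_vecI)
    show "v \<in> carrier_vec n" using v cyclic_codeD(1)[OF C] by blast
    fix \<beta> assume \<beta>: "\<beta> \<in> U"
    show "ev v \<beta> = 0"
    proof (cases "\<beta> \<in> ?D")
      case True
      then show ?thesis using v(2) unfolding zeros_def by blast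
    next
      case False
      then have "inverse \<beta> \<notin> ?D" using D by (metis inverse_inverse_eq)
      then have "\<beta> \<in> zeros C"
        using inverse_in_U[OF \<beta>] unfolding zeros_dual_code[OF C] by simp
      then show ?thesis using v(1) unfolding zeros_def by blast
    qed
  qed
  then show "LCD_code n C"
    unfolding LCD_code_def using cyclic_codeD(2)[OF C] cyclic_codeD(2)[OF cyclic_dual_code[OF C]]
    by blast
qed

end

subsection \<open>Cyclotomic cosets and the basic zero set\<close>

text \<open>By Euler's theorem some positive power of \<open>q\<close> returns to \<open>a\<close>,
  so \<open>coset_size\<close> is a genuine period and every exponent can be reduced modulo
  it.\<close>

lemma cyc_coset_iff:
  assumes n: "n > 0" and cop: "coprime q n"
  shows "b \<in> cyc_coset q n a \<longleftrightarrow> b \<in> {0..<int n} \<and> (\<exists>k. [b = a * int q ^ k] (mod int n))"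
proof
  assume "b \<in> cyc_coset q n a"
  then show "b \<in> {0..<int n} \<and> (\<exists>k. [b = a * int q ^ k] (mod int n))"
    using n by (auto simp: cyc_coset_def cong_def)
next
  assume b: "b \<in> {0..<int n} \<and> (\<exists>k. [b = a * int q ^ k] (mod int n))"
  then obtain k where k: "[b = a * int q ^ k] (mod int n)" by blast
  let ?d = "coset_size q n a"
  have "[q ^ totient n = 1] (mod n)" using cop by (rule euler_theorem)
  then have "[int q ^ totient n = 1] (mod int n)"
    by (metis cong_int_iff of_nat_1 of_nat_power)
  then have "[a * int q ^ totient n = a] (mod int n)"
    by (metis cong_scalar_left mult.right_neutral)
  then have d: "0 < ?d" "[a * int q ^ ?d = a] (mod int n)"
    unfolding coset_size_def using n
    by (metis (mono_tags, lifting) LeastI totient_gt_0_iff)+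
  have period: "[a * int q ^ (?d * j) = a] (mod int n)" for j
  proof (induction j)
    case (Suc j)
    have "[a * int q ^ (?d * j) * int q ^ ?d = a * int q ^ ?d] (mod int n)"
      by (rule cong_mult[OF Suc.IH cong_refl])
    then show ?case using d(2) by (simp add: power_add mult.assoc mult.commute[of "int q ^ ?d"] cong_trans)
  qed simp
  have split: "a * int q ^ k = a * int q ^ (?d * (k div ?d)) * int q ^ (k mod ?d)"
    by (simp add: mult.assoc flip: power_add)
  have "[a * int q ^ k = a * int q ^ (k mod ?d)] (mod int n)"
    by (subst split) (rule cong_mult[OF period cong_refl])
  then have "[b = a * int q ^ (k mod ?d)] (mod int n)" using k cong_trans by blast
  then have "b = (a * int q ^ (k mod ?d)) mod int n" using b by (simp add: cong_def)
  then show "b \<in> cyc_coset q n a" using d(1) by (auto simp: cyc_coset_def)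
qed

text \<open>Modulo \<open>n > 0\<close>, multiplying by \<open>q ^ ((totient n - 1) * k)\<close>
  undoes multiplication by \<open>q ^ k\<close>.\<close>

lemma cong_times_power_sym:
  assumes cop: "coprime q n" and "[b = a * int q ^ k] (mod int n)"
  obtains l where "[a = b * int q ^ l] (mod int n)"
proof -
  have "[q ^ totient n = 1] (mod n)" using cop by (rule euler_theorem)
  then have "[(q ^ totient n) ^ k = 1 ^ k] (mod n)" by (rule cong_pow)
  then have one: "[int q ^ (totient n * k) = 1] (mod int n)"
    by (metis cong_int_iff of_nat_1 of_nat_power power_mult power_one)
  show ?thesis
  proof (cases "n = 0")
    case True
    then have "q = 1" using cop by simp
    then show ?thesis using assms(2) that[of 0] True by (simp add: cong_def)
  next
    case False
    then have "totient n * k = k + (totient n - 1) * k"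
      using totient_gt_0_iff[of n] by (cases "totient n") auto
    then have "[a * (int q ^ k * int q ^ ((totient n - 1) * k)) = a * 1] (mod int n)"
      using cong_scalar_left[OF one, of a] by (simp only: power_add)
    moreover have "[b * int q ^ ((totient n - 1) * k) = a * int q ^ k * int q ^ ((totient n - 1) * k)] (mod int n)"
      by (rule cong_mult[OF assms(2) cong_refl])
    ultimately have "[b * int q ^ ((totient n - 1) * k) = a] (mod int n)"
      by (simp add: mult.assoc cong_def)
    then show ?thesis using that cong_sym by blast
  qed
qed

context cyclic_code_zeros
begin

text \<open>
  For \<open>d = gcd q n\<close> the element \<open>\<alpha> ^ (n div d)\<close> is mapped to 1 by the injective Frobenius map.
\<close>

lemma coprime_q_n: "coprime q n"
proof -
  interpret F: field_hom "\<lambda>x::'b. x ^ q" by (rule field_hom_frobenius)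
  let ?d = "gcd q n"
  obtain k where k: "n = ?d * k" by (metis dvdE gcd_dvd2)
  obtain l where l: "q = ?d * l" by (metis dvdE gcd_dvd1)
  have "(\<alpha> ^ k) ^ q = \<alpha> ^ (?d * k * l)"
    by (subst l) (simp add: power_mult[symmetric] mult_ac)
  also have "\<dots> = (\<alpha> ^ n) ^ l" by (simp only: k[symmetric] power_mult)
  also have "\<dots> = 1 ^ q" using primitive unfolding primitive_nth_root_def by simp
  finally have "\<alpha> ^ k = 1" by (rule injD[OF F.inj_f])
  moreover have "k > 0" using k n_pos by (metis mult_0_right neq0_conv)
  ultimately have "n \<le> k" using primitive unfolding primitive_nth_root_def by (metis not_le)
  then have "?d * k \<le> 1 * k" using k by linarith
  then have "?d \<le> 1" using \<open>k > 0\<close> by (simp only: mult_le_cancel2)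
  then have "?d = 1" using n_pos gcd_pos_nat[of q n] by linarith
  then show ?thesis by (simp only: coprime_iff_gcd_eq_1)
qed

lemma powi_cong:
  assumes "[a = b] (mod int n)"
  shows "\<alpha> powi a = \<alpha> powi b"
proof -
  obtain z where z: "b = a + int n * z" using assms by (metis cong_iff_lin)
  have "\<alpha> powi (int n * z) = (\<alpha> ^ n) powi z" by (simp add: power_int_mult)
  also have "\<dots> = 1" using primitive unfolding primitive_nth_root_def by simp
  finally show ?thesis using alpha_nonzero unfolding z by (simp add: power_int_add)
qed

lemma powi_cong_power:
  assumes "[b = a * int q ^ k] (mod int n)"
  shows "\<alpha> powi b = (\<alpha> powi a) ^ (q ^ k)"
  using power_int_of_nat[of "\<alpha> powi a" "q ^ k"]
  unfolding powi_cong[OF assms] by (simp add: power_int_mult)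

lemma zeros_power_q_power: "\<beta> \<in> zeros E \<Longrightarrow> \<beta> ^ (q ^ k) \<in> zeros E"
  by (induction k) (simp_all add: zeros_power_q power_mult mult.commute[of q])

text \<open>One direction is Frobenius stability; the other applies it to the reversed
  congruence.\<close>

lemma powi_in_zeros_cong:
  assumes "[b = a * int q ^ k] (mod int n)"
  shows "\<alpha> powi b \<in> zeros E \<longleftrightarrow> \<alpha> powi a \<in> zeros E"
proof -
  obtain l where "[a = b * int q ^ l] (mod int n)"
    using cong_times_power_sym[OF coprime_q_n assms] .
  then show ?thesis
    using powi_cong_power[OF assms] powi_cong_power zeros_power_q_power by metis
qed

lemma coset_poly_eq: "coset_poly q n \<alpha> a = root_poly ((\<lambda>s. \<alpha> powi s) ` cyc_coset q n a)"
proof -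
  have "inj_on (\<lambda>s. \<alpha> powi s) (cyc_coset q n a)"
    by (rule inj_on_subset[OF bij_betw_imp_inj_on[OF bij_betw_powi]])
      (auto simp: cyc_coset_iff[OF n_pos coprime_q_n])
  then show ?thesis unfolding coset_poly_def root_poly_def by (simp add: prod.reindex)
qed

lemma root_poly_inject:
  assumes "finite R" "finite T" "root_poly R = root_poly (T :: 'b set)"
  shows "R = T"
  using assms poly_root_poly_eq_0_iff by (metis subsetI subset_antisym)

section \<open>Coset leaders as an index set for the zeros of cyclic codes\<close>

context
  fixes t :: nat and i :: "nat \<Rightarrow> int"
  assumes leaders: "coset_leaders q n t i"
begin

lemmas coset_iff = cyc_coset_iff[OF n_pos coprime_q_n]

lemma leader_range: "j \<in> {1..t} \<Longrightarrow> i j \<in> {0..<int n}"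
  using leaders unfolding coset_leaders_def by blast

lemma leader_in_coset: "j \<in> {1..t} \<Longrightarrow> i j \<in> cyc_coset q n (i j)"
  unfolding coset_iff using leader_range by (auto intro!: exI[of _ 0])

text \<open>The uniqueness in \<open>coset_leaders\<close> concerns leaders lying in the coset of
  \<open>s\<close>, so both memberships are first reversed.\<close>

lemma leader_unique:
  assumes "j \<in> {1..t}" "j' \<in> {1..t}" "s \<in> cyc_coset q n (i j)" "s \<in> cyc_coset q n (i j')"
  shows "j = j'"
proof -
  have s: "s \<in> {0..<int n}" using assms(3) unfolding coset_iff by blast
  have "i l \<in> cyc_coset q n s" if l: "l \<in> {1..t}" "s \<in> cyc_coset q n (i l)" for l
  proof -
    obtain k where "[s = i l * int q ^ k] (mod int n)" using l(2) unfolding coset_iff by blast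
    then obtain k' where "[i l = s * int q ^ k'] (mod int n)"
      using cong_times_power_sym[OF coprime_q_n] by blast
    then show ?thesis using leader_range[OF l(1)] unfolding coset_iff by blast
  qed
  then have "i j \<in> cyc_coset q n s" "i j' \<in> cyc_coset q n s" using assms by auto
  then show ?thesis
    using leaders s assms(1,2) unfolding coset_leaders_def by blast
qed

text \<open>The integer \<open>s\<close> may be negative, as with \<open>- i j\<close> later; it is
  reduced modulo \<open>n\<close> because \<open>coset_leaders\<close> speaks of residues in
  \<open>{0..<int n}\<close>.\<close>

lemma obtain_leader:
  obtains j k where "j \<in> {1..t}" "[s = i j * int q ^ k] (mod int n)"
    "i j \<in> cyc_coset q n s"
proof -
  let ?r = "s mod int n"
  have "?r \<in> {0..<int n}" using n_pos by simp
  then obtain j where j: "j \<in> {1..t}" "i j \<in> cyc_coset q n ?r"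
    using leaders unfolding coset_leaders_def by blast
  then obtain l where "[i j = ?r * int q ^ l] (mod int n)" unfolding coset_iff by blast
  then have l: "[i j = s * int q ^ l] (mod int n)"
    by (simp add: cong_def mod_mult_left_eq)
  then obtain k where "[s = i j * int q ^ k] (mod int n)"
    using cong_times_power_sym[OF coprime_q_n] by blast
  then show ?thesis using that j(1) l leader_range[OF j(1)] unfolding coset_iff by blast
qed

definition leader_roots :: "nat \<Rightarrow> 'b set" where
  "leader_roots j = (\<lambda>s. \<alpha> powi s) ` cyc_coset q n (i j)"

lemma powi_in_leader_roots_iff:
  assumes "s \<in> {0..<int n}"
  shows "\<alpha> powi s \<in> leader_roots j \<longleftrightarrow> s \<in> cyc_coset q n (i j)"
proof -
  have "cyc_coset q n (i j) \<subseteq> {0..<int n}" by (auto simp: coset_iff)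
  then show ?thesis
    unfolding leader_roots_def
    using inj_on_image_mem_iff[OF bij_betw_imp_inj_on[OF bij_betw_powi] assms] by blast
qed

lemma finite_leader_roots: "finite (leader_roots j)"
  unfolding leader_roots_def cyc_coset_def by simp

text \<open>Different leaders have disjoint root sets, so the product of the coset polynomials has
  simple roots.\<close>

lemma prod_coset_poly:
  assumes S: "S \<subseteq> {1..t}"
  shows "(\<Prod>j\<in>S. coset_poly q n \<alpha> (i j)) = root_poly (\<Union>j\<in>S. leader_roots j)"
proof -
  have "leader_roots j \<inter> leader_roots j' = {}" if jj: "j \<in> S" "j' \<in> S" "j \<noteq> j'" for j j'
  proof (rule ccontr)
    assume "leader_roots j \<inter> leader_roots j' \<noteq> {}"
    then obtain s where s: "s \<in> cyc_coset q n (i j)" "\<alpha> powi s \<in> leader_roots j'"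
      unfolding leader_roots_def by blast
    then have "s \<in> cyc_coset q n (i j')"
      using powi_in_leader_roots_iff coset_iff by blast
    then show False using leader_unique s(1) jj S by blast
  qed
  moreover have "finite S" using S finite_subset by blast
  ultimately have "(\<Prod>\<beta>\<in>(\<Union>j\<in>S. leader_roots j). [:- \<beta>, 1:]) = (\<Prod>j\<in>S. \<Prod>\<beta>\<in>leader_roots j. [:- \<beta>, 1:])"
    by (intro prod.UNION_disjoint) (auto simp: finite_leader_roots)
  then show ?thesis
    unfolding coset_poly_eq root_poly_def leader_roots_def[symmetric] by simp
qed

text \<open>The description in \<open>BZ\<close> picks a unique index set: equal products have equal
  root sets, and the disjoint classes of the leaders can be read off from their union.\<close>

lemma powi_in_BZ_iff:
  assumes E: "cyclic_code n E" and j: "j \<in> {1..t}"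
  shows "\<alpha> powi (i j) \<in> BZ emb q n \<alpha> t i E \<longleftrightarrow> \<alpha> powi (i j) \<in> zeros E"
proof -
  \<comment> \<open>A class lies inside \<open>zeros E\<close> as soon as its leader does, so these
    classes make up exactly \<open>zeros E\<close>.\<close>
  define S0 where "S0 = {j \<in> {1..t}. \<alpha> powi (i j) \<in> zeros E}"
  have gen: "map_poly emb (generator_poly n E) = root_poly (zeros E)"
    by (rule map_poly_generator[OF is_generator_poly_generator_poly[OF n_pos E]])
  have fin: "finite (\<Union>j\<in>S. leader_roots j)" if "S \<subseteq> {1..t}" for S
    using finite_subset[OF that] by (simp add: finite_leader_roots)
  have S0_eq: "(\<Union>j\<in>S0. leader_roots j) = zeros E"
  proof (intro equalityI subsetI)
    fix \<beta> assume "\<beta> \<in> (\<Union>j\<in>S0. leader_roots j)"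
    then obtain j s where "j \<in> S0" "s \<in> cyc_coset q n (i j)" "\<beta> = \<alpha> powi s"
      unfolding leader_roots_def by blast
    then show "\<beta> \<in> zeros E"
      using powi_in_zeros_cong unfolding coset_iff S0_def by blast
  next
    fix \<beta> assume \<beta>: "\<beta> \<in> zeros E"
    then have "\<beta> \<in> (\<lambda>s. \<alpha> powi s) ` {0..<int n}"
      using zeros_subset_U bij_betw_imp_surj_on[OF bij_betw_powi] by blast
    then obtain s where s: "s \<in> {0..<int n}" "\<beta> = \<alpha> powi s" by blast
    obtain j k where j: "j \<in> {1..t}" "[s = i j * int q ^ k] (mod int n)"
      by (rule obtain_leader)
    then have "j \<in> S0" using powi_in_zeros_cong[OF j(2)] \<beta> s(2) unfolding S0_def by blast
    moreover have "s \<in> cyc_coset q n (i j)" using s(1) j(2) unfolding coset_iff by blast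
    then have "\<beta> \<in> leader_roots j" unfolding leader_roots_def s(2) by blast
    ultimately show "\<beta> \<in> (\<Union>j\<in>S0. leader_roots j)" by blast
  qed
  have "(THE S. S \<subseteq> {1..t} \<and> map_poly emb (generator_poly n E) = (\<Prod>j\<in>S. coset_poly q n \<alpha> (i j))) = S0"
  proof (rule the_equality)
    have "S0 \<subseteq> {1..t}" unfolding S0_def by blast
    then show "S0 \<subseteq> {1..t} \<and> map_poly emb (generator_poly n E) = (\<Prod>j\<in>S0. coset_poly q n \<alpha> (i j))"
      by (simp add: prod_coset_poly gen S0_eq)
  next
    fix S assume S: "S \<subseteq> {1..t} \<and> map_poly emb (generator_poly n E) = (\<Prod>j\<in>S. coset_poly q n \<alpha> (i j))"
    then have "root_poly (zeros E) = root_poly (\<Union>j\<in>S. leader_roots j)"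
      by (simp add: prod_coset_poly gen)
    then have eq: "zeros E = (\<Union>j\<in>S. leader_roots j)"
      using root_poly_inject finite_zeros fin S by blast
    show "S = S0"
    proof (intro equalityI subsetI)
      fix j assume j: "j \<in> S"
      then have "\<alpha> powi (i j) \<in> leader_roots j"
        using leader_in_coset S unfolding leader_roots_def by blast
      then show "j \<in> S0" using j S eq unfolding S0_def by blast
    next
      fix j assume j: "j \<in> S0"
      then have "\<alpha> powi (i j) \<in> zeros E" "j \<in> {1..t}" unfolding S0_def by auto
      then obtain j' where j': "j' \<in> S" "\<alpha> powi (i j) \<in> leader_roots j'" using eq by blast
      then have "i j \<in> cyc_coset q n (i j')"
        using powi_in_leader_roots_iff leader_range \<open>j \<in> {1..t}\<close> by blast
      then have "j = j'"
        using leader_unique leader_in_coset \<open>j \<in> {1..t}\<close> j'(1) S by blast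
      then show "j \<in> S" using j' by simp
    qed
  qed
  then have "BZ emb q n \<alpha> t i E = (\<lambda>j. \<alpha> powi (i j)) ` S0" unfolding BZ_def by simp
  then show ?thesis using j unfolding S0_def by auto
qed

end

end

section \<open>From closure under inversion to a condition on coset leaders\<close>

theorem theorem2:
  fixes emb :: "'a::{field,finite} \<Rightarrow> 'b::field"
    and \<alpha> :: 'b
    and q m n t :: nat
    and i :: "nat \<Rightarrow> int"
    and C :: "'a vec set"
  assumes "primepow q" and "card (UNIV :: 'a set) = q"
    and "m \<ge> 1" and "n = q ^ m - 1"
    and "field_hom emb"
    and "primitive_nth_root n \<alpha>"
    and "coset_leaders q n t i"
    and "cyclic_code n C"
  shows "LCD_code n C \<longleftrightarrow>
    (\<forall>j\<in>{1..t}. \<alpha> powi (i j) \<in> BZ emb q n \<alpha> t i (dual_code n C) \<longrightarrow>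
       cyc_coset q n (i j) = cyc_coset q n (- i j) \<or>
       (\<exists>k\<in>{1..t}. i k \<in> cyc_coset q n (- i j) \<and>
          \<alpha> powi (i k) \<in> BZ emb q n \<alpha> t i (dual_code n C)))"
proof -
  have "q ^ m > 1"
    using primepow_gt_Suc_0[OF assms(1)] assms(3) by (intro one_less_power) auto
  then have n: "n > 0" using assms(4) by simp
  interpret field_hom emb by fact
  interpret cyclic_code_zeros emb q n \<alpha>
    by unfold_locales (use assms n in auto)
  note leaders = assms(7)
  note C = assms(8)
  note dual = cyclic_dual_code[OF C]
  let ?D = "zeros (dual_code n C)"
  let ?cond = "\<lambda>j. cyc_coset q n (i j) = cyc_coset q n (- i j) \<or>
       (\<exists>k\<in>{1..t}. i k \<in> cyc_coset q n (- i j) \<and> \<alpha> powi (i k) \<in> ?D)"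
  have in_D: "\<alpha> powi b \<in> ?D \<longleftrightarrow> \<alpha> powi a \<in> ?D" if "b \<in> cyc_coset q n a" for a b
    using that powi_in_zeros_cong unfolding cyc_coset_iff[OF n_pos coprime_q_n] by blast
  \<comment> \<open>Both alternatives express the same fact: if the two cosets coincide,
    \<open>i j\<close> itself lies in the coset of \<open>- i j\<close>, and otherwise the leader
    \<open>i k\<close> stands in for \<open>- i j\<close>.\<close>
  have cond: "?cond j \<longleftrightarrow> \<alpha> powi (- i j) \<in> ?D" if j: "j \<in> {1..t}" "\<alpha> powi (i j) \<in> ?D" for j
  proof
    assume "?cond j"
    then show "\<alpha> powi (- i j) \<in> ?D"
      using in_D leader_in_coset[OF leaders j(1)] j(2) by blast
  next
    assume "\<alpha> powi (- i j) \<in> ?D"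
    moreover obtain k where "k \<in> {1..t}" "i k \<in> cyc_coset q n (- i j)"
      by (rule obtain_leader[OF leaders])
    ultimately show "?cond j" using in_D by blast
  qed
  have "(\<forall>\<beta>\<in>?D. inverse \<beta> \<in> ?D) \<longleftrightarrow>
    (\<forall>j\<in>{1..t}. \<alpha> powi (i j) \<in> ?D \<longrightarrow> \<alpha> powi (- i j) \<in> ?D)" (is "?L \<longleftrightarrow> ?R")
  proof
    assume ?L
    then show ?R by (simp add: power_int_minus)
  next
    assume R: ?R
    show ?L
    proof
      fix \<beta> assume \<beta>: "\<beta> \<in> ?D"
      then obtain s where s: "\<beta> = \<alpha> powi s"
        using zeros_subset_U bij_betw_imp_surj_on[OF bij_betw_powi] by blast
      obtain j k where j: "j \<in> {1..t}" "[s = i j * int q ^ k] (mod int n)"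
        by (rule obtain_leader[OF leaders])
      then have "\<alpha> powi (- i j) \<in> ?D"
        using R \<beta> powi_in_zeros_cong[OF j(2)] unfolding s by blast
      \<comment> \<open>Negation commutes with multiplication by powers of \<open>q\<close>, so the
        condition at the leader carries over to every element of its coset.\<close>
      moreover have "[- s = - i j * int q ^ k] (mod int n)"
        using j(2) cong_minus_minus_iff[of s "i j * int q ^ k" "int n"] by simp
      ultimately have "\<alpha> powi (- s) \<in> ?D" using powi_in_zeros_cong by blast
      then show "inverse \<beta> \<in> ?D" unfolding s by (simp add: power_int_minus)
    qed
  qed
  then show ?thesis
    unfolding LCD_code_iff_zeros[OF C]
    using cond by (simp add: powi_in_BZ_iff[OF leaders dual] cong: conj_cong)
qed

end
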